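(* Let $T>0$, let $q\ge 2$ be an integer, let $\frac{2}{3}<H<\frac{3}{4}$, and let $B=\{B_t\}_{t\ge0}$ be a one-dimensional fractional Brownian motion with Hurst parameter $H$. Then the random variables $I_{2q-1}(f_{2q-1,\varepsilon})$ converge in $L^2(\Omega,\mathcal F,\mathbb P)$ as $\varepsilon\to0$.
   Context: Fractional Brownian motion: a centered Gaussian process $\{B_t\}_{t\ge0}$ on $(\Omega,\mathcal F,\mathbb P)$ with $\mathbb E[B_tB_s]=\frac12(t^{2H}+s^{2H}-|t-s|^{2H})$. $\mathfrak H$ is the Hilbert space obtained by completing the space of step functions on $[0,\infty)$ with respect to the inner product $\langle \mathbf 1_{[a,b]},\mathbf 1_{[c,d]}\rangle_{\mathfrak H}=\mathbb E[(B_b-B_a)(B_d-B_c)]$; the map $\mathbf 1_{[0,t]}\mapsto B_t$ extends to a linear isometry $h\mapsto B(h)$ from $\mathfrak H$ into $L^2(\Omega,\mathcal F,\mathbb P)$. For an integer $m\ge1$, $\mathfrak H^{\otimes m}$ and $\mathfrak H^{\odot m}$ are the $m$-th tensor power and symmetric tensor power, $H_m(x)=(-1)^m e^{x^2/2}\frac{d^m}{dx^m}e^{-x^2/2}$ is the $m$-th Hermite polynomial, and $\mathcal H_m$ (the $m$-th Wiener chaos) is the closed linear span in $L^2(\Omega,\mathcal F,\mathbb P)$ of $\{H_m(B(h)):h\in\mathfrak H,\|h\|_{\mathfrak H}=1\}$. $I_m$ is the linear isometry from $\mathfrak H^{\odot m}$ (with norm $\sqrt{m!}\,\|\cdot\|_{\mathfrak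 H^{\otimes m}}$) onto $\mathcal H_m$ determined by $I_m(h^{\otimes m})=H_m(B(h))$ for $\|h\|_{\mathfrak H}=1$. For integers $q\ge1$, $\varepsilon>0$ and $0\le s\le t$ set $$\beta_q=\frac{1}{2^{q-\frac12}(q-1)!\sqrt\pi},\qquad f_{2q-1,\varepsilon,s,t}=(-1)^q\beta_q\,(\varepsilon+(t-s)^{2H})^{-q-\frac12}\,\mathbf 1_{[s,t]}^{\otimes(2q-1)},$$ $$f_{2q-1,\varepsilon}=\int_{\{0\le s\le t\le T\}} f_{2q-1,\varepsilon,s,t}\,ds\,dt\in\mathfrak H^{\odot(2q-1)}.$$ Thus $I_{2q-1}(f_{2q-1,\varepsilon})$ is the projection onto $\mathcal H_{2q-1}$ of $\alpha_\varepsilon=\int_0^T\int_0^t p_\varepsilon'(B_t-B_s)\,ds\,dt$, where $p_\varepsilon(x)=(2\pi\varepsilon)^{-1/2}e^{-x^2/(2\varepsilon)}$. *)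

theory Defs
  imports "HOL-Probability.Probability" "HOL-Combinatorics.Permutations"
begin

section \<open>Square-integrable random variables\<close>

text \<open>
  Elements of \<open>L\<^sup>2\<close> are represented by functions; equality in \<open>L\<^sup>2\<close> is equality almost everywhere.
\<close>

definition L2_rv :: "'w measure \<Rightarrow> ('w \<Rightarrow> real) set" where
  "L2_rv M = {X \<in> borel_measurable M. integrable M (\<lambda>\<omega>. (X \<omega>)\<^sup>2)}"

definition converges_L2 :: "'w measure \<Rightarrow> ('i \<Rightarrow> 'w \<Rightarrow> real) \<Rightarrow> 'i filter \<Rightarrow> bool" where
  "converges_L2 M X F \<longleftrightarrow>
     (\<forall>\<^sub>F i in F. X i \<in> L2_rv M) \<and>
     (\<exists>Y \<in> L2_rv M. ((\<lambda>i. \<integral>\<omega>. (X i \<omega> - Y \<omega>)\<^sup>2 \<partial>M) \<longlongrightarrow> 0) F)"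

text \<open>
  The next predicate describes maps from a linear subspace \<open>S\<close> of a Hilbert space to \<open>L\<^sup>2\<close> that are
  linear and multiply norms by \<open>sqrt c\<close>.
\<close>

definition linear_isometry_into_L2 ::
    "'w measure \<Rightarrow> real \<Rightarrow> 'v::real_inner set \<Rightarrow> ('v \<Rightarrow> 'w \<Rightarrow> real) \<Rightarrow> bool" where
  "linear_isometry_into_L2 M c S U \<longleftrightarrow>
     (\<forall>x\<in>S. U x \<in> L2_rv M) \<and>
     (\<forall>x\<in>S. \<forall>y\<in>S. \<forall>a b. AE \<omega> in M. U (a *\<^sub>R x + b *\<^sub>R y) \<omega> = a * U x \<omega> + b * U y \<omega>) \<and>
     (\<forall>x\<in>S. (\<integral>\<omega>. (U x \<omega>)\<^sup>2 \<partial>M) = c * (norm x)\<^sup>2)"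


section \<open>Fractional Brownian motion\<close>

text \<open>Constants count as (degenerate) Gaussian variables, as usual for Gaussian processes.\<close>

definition gaussian_rv :: "'w measure \<Rightarrow> ('w \<Rightarrow> real) \<Rightarrow> bool" where
  "gaussian_rv M X \<longleftrightarrow> X \<in> borel_measurable M \<and>
     ((\<exists>\<mu>. AE \<omega> in M. X \<omega> = \<mu>) \<or>
      (\<exists>\<mu> \<sigma>. \<sigma> > 0 \<and> distributed M lborel X (normal_density \<mu> \<sigma>)))"

text \<open>
  Processes are indexed by all reals, but only the times \<open>t \<ge> 0\<close> matter. A process is Gaussian if all
  finite linear combinations of its values are Gaussian.
\<close>

definition gaussian_process :: "'w measure \<Rightarrow> (real \<Rightarrow> 'w \<Rightarrow> real) \<Rightarrow> bool" where
  "gaussian_process M B \<longleftrightarrow>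
     (\<forall>A c. finite A \<and> A \<subseteq> {0..} \<longrightarrow> gaussian_rv M (\<lambda>\<omega>. \<Sum>t\<in>A. c t * B t \<omega>))"

definition fractional_brownian_motion ::
    "'w measure \<Rightarrow> real \<Rightarrow> (real \<Rightarrow> 'w \<Rightarrow> real) \<Rightarrow> bool" where
  "fractional_brownian_motion M H B \<longleftrightarrow>
     prob_space M \<and> 0 < H \<and> H < 1 \<and>
     gaussian_process M B \<and>
     (\<forall>t\<ge>0. (\<integral>\<omega>. B t \<omega> \<partial>M) = 0) \<and>
     (\<forall>s\<ge>0. \<forall>t\<ge>0. (\<integral>\<omega>. B t \<omega> * B s \<omega> \<partial>M) =
        (t powr (2 * H) + s powr (2 * H) - \<bar>t - s\<bar> powr (2 * H)) / 2)"


section \<open>The Hilbert space of the process\<close>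

definition step_functions :: "(real \<Rightarrow> real) set" where
  "step_functions =
     {\<phi>. \<exists>(n::nat) c a b. (\<forall>i<n. 0 \<le> a i \<and> a i \<le> b i) \<and>
           \<phi> = (\<lambda>u. \<Sum>i<n. c i * indicator {a i..b i} u)}"

text \<open>
  A completion of the step functions consists of a Hilbert space (here a type \<open>'h\<close>) and a linear map
  \<open>emb\<close> with dense image from step functions to it that carries the given (semi-)inner product to
  that of \<open>'h\<close>. This determines \<open>'h\<close> up to a unique isometry; \<open>emb (indicator {a..b})\<close> is the element
  \<open>1\<^bsub>[a,b]\<^esub>\<close>.
\<close>

definition step_completion ::
    "'w measure \<Rightarrow> (real \<Rightarrow> 'w \<Rightarrow> real) \<Rightarrow> ((real \<Rightarrow> real) \<Rightarrow> 'h::{real_inner,banach}) \<Rightarrow> bool" where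
  "step_completion M B emb \<longleftrightarrow>
     (\<forall>\<phi>\<in>step_functions. \<forall>\<psi>\<in>step_functions. \<forall>x y.
        emb (\<lambda>u. x * \<phi> u + y * \<psi> u) = x *\<^sub>R emb \<phi> + y *\<^sub>R emb \<psi>) \<and>
     (\<forall>a b c d. 0 \<le> a \<and> a \<le> b \<and> 0 \<le> c \<and> c \<le> d \<longrightarrow>
        emb (indicator {a..b}) \<bullet> emb (indicator {c..d}) =
          (\<integral>\<omega>. (B b \<omega> - B a \<omega>) * (B d \<omega> - B c \<omega>) \<partial>M)) \<and>
     closure (emb ` step_functions) = UNIV"

text \<open>The linear isometry \<open>h \<mapsto> B(h)\<close>, here \<open>W\<close>, that extends \<open>1\<^bsub>[0,t]\<^esub> \<mapsto> B\<^sub>t\<close>.\<close>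

definition wiener_isometry ::
    "'w measure \<Rightarrow> (real \<Rightarrow> 'w \<Rightarrow> real) \<Rightarrow> ((real \<Rightarrow> real) \<Rightarrow> 'h::{real_inner,banach})
     \<Rightarrow> ('h \<Rightarrow> 'w \<Rightarrow> real) \<Rightarrow> bool" where
  "wiener_isometry M B emb W \<longleftrightarrow>
     linear_isometry_into_L2 M 1 UNIV W \<and>
     (\<forall>t\<ge>0. AE \<omega> in M. W (emb (indicator {0..t})) \<omega> = B t \<omega>)"


section \<open>Tensor powers\<close>

text \<open>
  A Hilbert space \<open>'k\<close> with a map \<open>tens\<close>, sending \<open>h\<close> to \<open>h 0 \<otimes> \<dots> \<otimes> h (m - 1)\<close>, is an \<open>m\<close>-th tensor
  power of \<open>'h\<close> if \<open>tens\<close> is multilinear, inner products of elementary tensors are products of inner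
  products, and elementary tensors span a dense subspace. This determines it up to a unique isometry.
  Only the values \<open>h i\<close> with \<open>i < m\<close> matter: by the inner product condition, \<open>tens\<close> does not depend
  on the others.
\<close>

definition hilbert_tensor_power ::
    "nat \<Rightarrow> ((nat \<Rightarrow> 'h::{real_inner,banach}) \<Rightarrow> 'k::{real_inner,banach}) \<Rightarrow> bool" where
  "hilbert_tensor_power m tens \<longleftrightarrow>
     (\<forall>h. \<forall>i<m. linear (\<lambda>x. tens (h(i := x)))) \<and>
     (\<forall>g h. tens g \<bullet> tens h = (\<Prod>i<m. g i \<bullet> h i)) \<and>
     closure (span (range tens)) = UNIV"

abbreviation tensor_pow :: "((nat \<Rightarrow> 'h) \<Rightarrow> 'k) \<Rightarrow> 'h \<Rightarrow> 'k" where
  "tensor_pow tens h \<equiv> tens (\<lambda>_. h)"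

text \<open>The symmetric tensor power is the closed subspace generated by symmetrised elementary tensors.\<close>

definition symmetric_power ::
    "nat \<Rightarrow> ((nat \<Rightarrow> 'h::{real_inner,banach}) \<Rightarrow> 'k::{real_inner,banach}) \<Rightarrow> 'k set" where
  "symmetric_power m tens =
     closure (span (range (\<lambda>h. \<Sum>\<pi> | \<pi> permutes {..<m}. tens (h \<circ> \<pi>))))"


section \<open>Wiener chaos and multiple integrals\<close>

definition hermite :: "nat \<Rightarrow> real \<Rightarrow> real" where
  "hermite m x = (- 1) ^ m * exp (x\<^sup>2 / 2) * (deriv ^^ m) (\<lambda>y. exp (- (y\<^sup>2 / 2))) x"

definition wiener_chaos ::
    "'w measure \<Rightarrow> ('h::{real_inner,banach} \<Rightarrow> 'w \<Rightarrow> real) \<Rightarrow> nat \<Rightarrow> ('w \<Rightarrow> real) set" where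
  "wiener_chaos M W m =
     {Y \<in> L2_rv M. \<forall>e>0. \<exists>(n::nat) c h. (\<forall>i<n. norm (h i) = 1) \<and>
        (\<integral>\<omega>. (Y \<omega> - (\<Sum>i<n. c i * hermite m (W (h i) \<omega>)))\<^sup>2 \<partial>M) < e}"

definition multiple_wiener_integral ::
    "'w measure \<Rightarrow> ('h::{real_inner,banach} \<Rightarrow> 'w \<Rightarrow> real) \<Rightarrow> nat
     \<Rightarrow> ((nat \<Rightarrow> 'h) \<Rightarrow> 'k::{real_inner,banach}) \<Rightarrow> ('k \<Rightarrow> 'w \<Rightarrow> real) \<Rightarrow> bool" where
  "multiple_wiener_integral M W m tens I \<longleftrightarrow>
     linear_isometry_into_L2 M (fact m) (symmetric_power m tens) I \<and>
     (\<forall>x\<in>symmetric_power m tens. I x \<in> wiener_chaos M W m) \<and>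
     (\<forall>Y\<in>wiener_chaos M W m. \<exists>x\<in>symmetric_power m tens. AE \<omega> in M. I x \<omega> = Y \<omega>) \<and>
     (\<forall>h. norm h = 1 \<longrightarrow> (AE \<omega> in M. I (tensor_pow tens h) \<omega> = hermite m (W h \<omega>)))"


section \<open>The kernels\<close>

definition kernel_coeff :: "nat \<Rightarrow> real" where
  "kernel_coeff q = 1 / (2 powr (real q - 1 / 2) * fact (q - 1) * sqrt pi)"

definition kernel_at ::
    "((real \<Rightarrow> real) \<Rightarrow> 'h::{real_inner,banach}) \<Rightarrow> ((nat \<Rightarrow> 'h) \<Rightarrow> 'k::{real_inner,banach})
     \<Rightarrow> real \<Rightarrow> nat \<Rightarrow> real \<Rightarrow> real \<Rightarrow> real \<Rightarrow> 'k" where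
  "kernel_at emb tens H q \<epsilon> s t =
     ((- 1) ^ q * kernel_coeff q * (\<epsilon> + (t - s) powr (2 * H)) powr (- real q - 1 / 2))
       *\<^sub>R tensor_pow tens (emb (indicator {s..t}))"

text \<open>
  The integral is a Bochner integral with values in the tensor power (in which \<open>tens\<close> has \<open>2q-1\<close> factors).
  The library's Bochner integral requires \<open>second_countable_topology\<close>, i.e. separability of \<open>'k\<close>; a tensor power
  of the completed step functions of a fractional Brownian motion is always separable.
\<close>

definition chaos_kernel ::
    "((real \<Rightarrow> real) \<Rightarrow> 'h::{real_inner,banach})
     \<Rightarrow> ((nat \<Rightarrow> 'h) \<Rightarrow> 'k::{real_inner,banach,second_countable_topology})
     \<Rightarrow> real \<Rightarrow> real \<Rightarrow> nat \<Rightarrow> real \<Rightarrow> 'k" where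
  "chaos_kernel emb tens H T q \<epsilon> =
     set_lebesgue_integral lborel {(s, t). 0 \<le> s \<and> s \<le> t \<and> t \<le> T}
       (\<lambda>(s, t). kernel_at emb tens H q \<epsilon> s t)"

end

(* The chaos isometry reduces the claim to convergence of the kernels in the tensor power, i.e. to the
   integrability over pairs of time intervals of (u v)^(-H(2q+1)) m^(2q-1), where u, v are the lengths of
   the intervals and m is the covariance of the increments; once this is known, dominated convergence
   makes the kernels a Cauchy family.
   Let r be the distance of the left end points. Besides Cauchy-Schwarz, m <= (u v)^H, one has
   m <= C u v r^(2H-2). Interpolating with the exponent p on the second bound that satisfies
   p (1 - H) = H - 1/4 (for H < 3/4 this gives p < 2 <= 2q - 1) bounds the integrand by
   C (u v)^(-(H+1/4)) r^(-(2H-1/2)), a product of integrable singularities. *)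
theory Submission imports Defs
begin

section \<open>Increments of fractional Brownian motion\<close>

text \<open>At \<open>\<epsilon> = 0\<close> the integrand has norm
  \<open>\<bar>kernel_coeff q\<bar> * (t - s) powr (- 2 * H)\<close>, which is not integrable over
  the triangle because \<open>2 * H > 1\<close>. So the limit is not a Bochner integral of the
  kernel at 0, and estimating norms under the integral cannot succeed. What helps is that increments
  over distant intervals are nearly uncorrelated: the squared norm of an integral is expanded into a
  double integral of inner products, and the limit exists by completeness only. The comparison is
  still made with the singular weight at 0. Off the diagonal the weights grow as
  \<open>\<epsilon>\<close> decreases, so the gap between the weights at
  \<open>\<eta> \<le> \<epsilon>\<close> and at \<open>\<epsilon>\<close> is at most the gap between
  those at 0 and at \<open>\<epsilon>\<close>. A single scalar double integral, tending to 0 with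
  \<open>\<epsilon>\<close>, thus controls all \<open>\<eta> \<le> \<epsilon>\<close> at
  once.\<close>

lemma powr_diff_le:
  fixes x y r :: real
  assumes "0 \<le> x" "x \<le> y" "1 \<le> r"
  shows "y powr r - x powr r \<le> r * y powr (r - 1) * (y - x)"
proof (cases "x = y")
  case False
  then have "x < y" using assms by simp
  moreover have "continuous_on {x..y} (\<lambda>z. z powr r)"
    using assms by (intro continuous_on_powr') (auto intro!: continuous_intros)
  moreover have "((\<lambda>z. z powr r) has_derivative (*) (r * z powr (r - 1))) (at z)"
    if "x < z" "z < y" for z
    using has_real_derivative_powr[of z r] that assms by (simp add: has_field_derivative_def)
  ultimately obtain z where z: "x < z" "z < y"
      "y powr r - x powr r = r * z powr (r - 1) * (y - x)"
    by (rule mvt[of x y "\<lambda>z. z powr r" "\<lambda>z. (*) (r * z powr (r - 1))"]) auto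
  have "z powr (r - 1) \<le> y powr (r - 1)"
    using z assms by (intro powr_mono2) auto
  then show ?thesis
    unfolding z(3) using assms \<open>x < y\<close> by (intro mult_right_mono mult_left_mono) auto
qed simp

text \<open>The mean value bound survives across the origin, since \<open>\<bar>a\<bar>\<close> and
  \<open>\<bar>b\<bar>\<close> are no farther apart than \<open>a\<close> and \<open>b\<close>. It
  serves overlapping intervals, where differences of end points may change sign.\<close>

lemma abs_powr_diff_le:
  fixes a b r R :: real
  assumes "\<bar>a\<bar> \<le> R" "\<bar>b\<bar> \<le> R" "1 \<le> r"
  shows "\<bar>\<bar>a\<bar> powr r - \<bar>b\<bar> powr r\<bar> \<le> r * R powr (r - 1) * \<bar>a - b\<bar>"
proof -
  have *: "\<bar>y powr r - x powr r\<bar> \<le> r * R powr (r - 1) * (y - x)"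
    if "0 \<le> x" "x \<le> y" "y \<le> R" for x y
  proof -
    have "x powr r \<le> y powr r" using that assms by (intro powr_mono2) auto
    then have "\<bar>y powr r - x powr r\<bar> \<le> r * y powr (r - 1) * (y - x)"
      using powr_diff_le[of x y r] that assms by simp
    also have "\<dots> \<le> r * R powr (r - 1) * (y - x)"
      using that assms by (intro mult_right_mono mult_left_mono powr_mono2) auto
    finally show ?thesis .
  qed
  have "\<bar>\<bar>a\<bar> powr r - \<bar>b\<bar> powr r\<bar> \<le> r * R powr (r - 1) * \<bar>\<bar>a\<bar> - \<bar>b\<bar>\<bar>"
    using *[of "\<bar>a\<bar>" "\<bar>b\<bar>"] *[of "\<bar>b\<bar>" "\<bar>a\<bar>"] assms
    by (cases "\<bar>a\<bar> \<le> \<bar>b\<bar>") (auto simp: abs_minus_commute)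
  also have "\<dots> \<le> r * R powr (r - 1) * \<bar>a - b\<bar>"
    using assms by (intro mult_left_mono) auto
  finally show ?thesis .
qed

text \<open>One mean value step in direction \<open>h\<close> and one in direction \<open>k\<close>
  give the value \<open>r * (r - 1) * y powr (r - 2) * h * k\<close> at some \<open>y > x\<close>.
  As \<open>r \<le> 2\<close>, the power decreases in \<open>y\<close>, so \<open>x\<close> gives
  the largest value.\<close>

lemma powr_second_difference:
  fixes x h k r :: real
  assumes "0 < x" "0 \<le> h" "0 \<le> k" "1 \<le> r" "r \<le> 2"
  shows "\<bar>(x + h + k) powr r - (x + h) powr r - (x + k) powr r + x powr r\<bar>
    \<le> r * (r - 1) * x powr (r - 2) * h * k"
proof (cases "h = 0 \<or> k = 0")
  case False
  define g where "g z = (z + k) powr r - z powr r" for z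
  have "\<exists>z. x < z \<and> z < x + h \<and> g (x + h) - g x
      = (x + h - x) * (r * (z + k) powr (r - 1) - r * z powr (r - 1))"
    unfolding g_def using assms False
    by (intro MVT2) (auto intro!: derivative_eq_intros)
  then obtain z where z: "x < z" "z < x + h"
      "g (x + h) - g x = h * (r * ((z + k) powr (r - 1) - z powr (r - 1)))"
    by (auto simp: algebra_simps)
  have "\<exists>y. z < y \<and> y < z + k \<and> (z + k) powr (r - 1) - z powr (r - 1)
      = (z + k - z) * ((r - 1) * y powr (r - 1 - 1))"
    using assms False z
    by (intro MVT2) (auto intro!: derivative_eq_intros)
  then obtain y where y: "z < y" "y < z + k"
      "(z + k) powr (r - 1) - z powr (r - 1) = k * ((r - 1) * y powr (r - 2))"
    by auto
  have "(x + h + k) powr r - (x + h) powr r - (x + k) powr r + x powr r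
      = r * (r - 1) * y powr (r - 2) * h * k"
    using z(3) unfolding y(3) g_def by (simp add: algebra_simps)
  moreover have "y powr (r - 2) \<le> x powr (r - 2)"
    using y z assms by (intro powr_mono2') auto
  ultimately show ?thesis
    using assms by (auto intro!: mult_right_mono mult_left_mono simp: abs_mult)
qed (use assms in auto)

text \<open>The pairs hold the end points of two time intervals. The explicit form separates the
  estimates from probability; \<open>fbm_increment_cov\<close> identifies it with the
  expectation.\<close>

definition increment_cov :: "real \<Rightarrow> real \<times> real \<Rightarrow> real \<times> real \<Rightarrow> real" where
  "increment_cov H x y =
     (\<bar>snd x - fst y\<bar> powr (2 * H) + \<bar>fst x - snd y\<bar> powr (2 * H)
       - \<bar>snd x - snd y\<bar> powr (2 * H) - \<bar>fst x - fst y\<bar> powr (2 * H)) / 2"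

lemma increment_cov_commute: "increment_cov H x y = increment_cov H y x"
  by (simp add: increment_cov_def abs_minus_commute)

text \<open>The covariance is a second difference of \<open>\<bar>x\<bar> powr (2 * H)\<close>, but
  the second-order estimate needs arguments away from 0. As \<open>s < u\<close>, this is so when
  the left interval is shorter than half the distance \<open>d\<close>, whatever the length of the
  other one. If the left interval is long and the right one short, a first difference in the end
  points of the right one is enough; if both are long, Cauchy-Schwarz is.\<close>

lemma increment_cov_le_aux:
  fixes H s t u v :: real
  assumes H: "1/2 < H" "H < 1" and st: "s \<le> t" and uv: "u \<le> v" and su: "s < u"
    and CS: "\<bar>increment_cov H (s, t) (u, v)\<bar> \<le> ((t - s) * (v - u)) powr H"
  shows "\<bar>increment_cov H (s, t) (u, v)\<bar>
    \<le> 24 * (t - s) * (v - u) * \<bar>s - u\<bar> powr (2 * H - 2)"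
proof -
  define h k d where "h = t - s" "k = v - u" "d = u - s"
  note hkd = this
  have pos: "0 \<le> h" "0 \<le> k" "0 < d" using assms by (auto simp: hkd)
  \<comment> \<open>Halving \<open>d\<close> costs a factor of at most 4; with the 6 below this
    makes 24.\<close>
  have d2: "(d / 2) powr (2 * H - 2) \<le> 4 * d powr (2 * H - 2)"
  proof -
    have "(d / 2) powr (2 * H - 2) = 2 powr (2 - 2 * H) * d powr (2 * H - 2)"
      using pos powr_minus_divide[of 2 "2 * H - 2"] by (simp add: powr_divide)
    moreover have "(2::real) powr (2 - 2 * H) \<le> 2 powr 2"
      using H by (intro powr_mono) auto
    ultimately show ?thesis by (auto intro!: mult_right_mono)
  qed
  have "\<bar>increment_cov H (s, t) (u, v)\<bar> \<le> 6 * (h * k * (d / 2) powr (2 * H - 2))"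
  proof -
    consider "h = 0 \<or> k = 0" | "h \<ge> d / 2" "k \<ge> d / 2" | "h \<ge> d / 2" "k \<le> d / 2" "k > 0"
      | "h \<le> d / 2" "h > 0" "k > 0" using pos by linarith
    then show ?thesis
    proof cases
      case 1
      then show ?thesis using CS by (auto simp: hkd)
    next
      case 2
      then have hk: "0 < h * k" using pos by auto
      have "(h * k) powr H = h * k * (h * k) powr (H - 1)"
        using hk by (simp add: powr_diff)
      also have "\<dots> \<le> h * k * ((d / 2) * (d / 2)) powr (H - 1)"
        using 2 pos H hk by (intro mult_left_mono powr_mono2' mult_mono) auto
      also have "((d / 2) * (d / 2)) powr (H - 1) = (d / 2) powr (2 * H - 2)"
        by (simp only: powr_mult powr_add[symmetric]) simp
      also have "h * k * (d / 2) powr (2 * H - 2) \<le> 6 * (h * k * (d / 2) powr (2 * H - 2))"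
        using mult_nonneg_nonneg[OF less_imp_le[OF hk] powr_ge_zero[of "d / 2" "2 * H - 2"]]
        by linarith
      finally show ?thesis using CS by (simp add: hkd)
    next
      case 3
      \<comment> \<open>The terms are paired so that the arguments in a pair differ by
        \<open>k\<close>. The largest argument is \<open>v - s = d + k \<le> 3 * h\<close>; this 3
        and \<open>2 * H \<le> 2\<close> produce the 6.\<close>
      have k: "\<bar>(s - v) - (s - u)\<bar> = k" "\<bar>(t - u) - (t - v)\<bar> = k"
        using uv by (auto simp: hkd)
      have "\<bar>\<bar>s - v\<bar> powr (2 * H) - \<bar>s - u\<bar> powr (2 * H)\<bar>
          \<le> 2 * H * (3 * h) powr (2 * H - 1) * k"
        unfolding k(1)[symmetric]
        using 3 H pos by (intro abs_powr_diff_le) (auto simp: hkd)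
      moreover have "\<bar>\<bar>t - u\<bar> powr (2 * H) - \<bar>t - v\<bar> powr (2 * H)\<bar>
          \<le> 2 * H * (3 * h) powr (2 * H - 1) * k"
        unfolding k(2)[symmetric]
        using 3 H pos by (intro abs_powr_diff_le) (auto simp: hkd)
      moreover have "\<bar>(a + b - c - e) / 2\<bar> \<le> R"
        if "\<bar>b - e\<bar> \<le> R" "\<bar>a - c\<bar> \<le> R" for a b c e R :: real
        using that by (simp add: abs_le_iff field_simps)
      ultimately have "\<bar>increment_cov H (s, t) (u, v)\<bar> \<le> 2 * H * (3 * h) powr (2 * H - 1) * k"
        unfolding increment_cov_def fst_conv snd_conv by blast
      also have "(3 * h) powr (2 * H - 1) = 3 * h * (3 * h) powr (2 * H - 2)"
        using 3 pos powr_add[of "3 * h" 1 "2 * H - 2"] by simp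
      also have "2 * H * (3 * h * (3 * h) powr (2 * H - 2)) * k
          \<le> 2 * 1 * (3 * h * (d / 2) powr (2 * H - 2)) * k"
        using 3 pos H by (intro mult_mono powr_mono2' mult_nonneg_nonneg) auto
      finally show ?thesis by (simp add: algebra_simps)
    next
      case 4
      \<comment> \<open>Here \<open>t\<close> lies to the left of \<open>u\<close> at distance
        \<open>d - h \<ge> d / 2\<close>, so no absolute value changes sign and \<open>d - h\<close>
        can serve as base point.\<close>
      have "\<bar>(d - h + h + k) powr (2 * H) - (d - h + h) powr (2 * H) - (d - h + k) powr (2 * H)
            + (d - h) powr (2 * H)\<bar>
          \<le> 2 * H * (2 * H - 1) * (d - h) powr (2 * H - 2) * h * k"
        using 4 pos H by (intro powr_second_difference) auto
      moreover have "increment_cov H (s, t) (u, v) = ((d - h + h + k) powr (2 * H)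
          - (d - h + h) powr (2 * H) - (d - h + k) powr (2 * H) + (d - h) powr (2 * H)) / 2"
      proof -
        have "\<bar>t - u\<bar> = d - h" "\<bar>s - v\<bar> = d - h + h + k" "\<bar>t - v\<bar> = d - h + k"
            "\<bar>s - u\<bar> = d - h + h"
          using 4 pos by (auto simp: hkd)
        then show ?thesis by (simp add: increment_cov_def)
      qed
      ultimately have "\<bar>increment_cov H (s, t) (u, v)\<bar>
          \<le> H * (2 * H - 1) * (d - h) powr (2 * H - 2) * h * k" by simp
      also have "\<dots> \<le> 1 * 1 * (d / 2) powr (2 * H - 2) * h * k"
        using 4 pos H by (intro mult_mono powr_mono2' mult_nonneg_nonneg) auto
      also have "\<dots> \<le> 6 * (h * k * (d / 2) powr (2 * H - 2))"
        using pos by (simp add: algebra_simps)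
      finally show ?thesis .
    qed
  qed
  also have "\<dots> \<le> 6 * (h * k * (4 * d powr (2 * H - 2)))"
    using pos d2 by (intro mult_left_mono) auto
  finally show ?thesis using su by (simp add: hkd abs_minus_commute algebra_simps)
qed

lemma increment_cov_le:
  fixes H s t u v :: real
  assumes H: "1/2 < H" "H < 1" and st: "s \<le> t" and uv: "u \<le> v" and su: "s \<noteq> u"
    and CS: "\<bar>increment_cov H (s, t) (u, v)\<bar> \<le> ((t - s) * (v - u)) powr H"
  shows "\<bar>increment_cov H (s, t) (u, v)\<bar>
    \<le> 24 * (t - s) * (v - u) * \<bar>s - u\<bar> powr (2 * H - 2)"
proof (cases "s < u")
  case True
  then show ?thesis using increment_cov_le_aux assms by blast
next
  case False
  then show ?thesis
    using increment_cov_le_aux[of H u v s t] assms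
    by (simp add: increment_cov_commute[of H "(s, t)"] abs_minus_commute algebra_simps)
qed

text \<open>Out of \<open>2 * q - 1\<close> factors \<open>m\<close>, \<open>p\<close> are estimated
  by \<open>A1\<close> and the rest by \<open>CS\<close>. This leaves \<open>P\<close> with the
  exponent \<open>p * (1 - H) - 2 * H\<close> and \<open>d\<close> with
  \<open>- 2 * p * (1 - H)\<close>. Both exceed -1 exactly when \<open>p * (1 - H)\<close> lies
  strictly between \<open>2 * H - 1\<close> and \<open>1/2\<close>; for \<open>H < 3/4\<close> this
  window is nonempty, and \<open>H - 1/4\<close> is its midpoint. The constant is the square of 24,
  from \<open>p \<le> 2\<close>.\<close>

lemma power_kernel_le:
  fixes H P d m :: real and q :: nat
  assumes H: "2/3 < H" "H < 3/4" and q: "2 \<le> q" and P: "0 < P" and d: "0 < d" and m: "0 \<le> m"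
    and CS: "m \<le> P powr H" and A1: "m \<le> 24 * P * d powr (2 * H - 2)"
  shows "m ^ (2 * q - 1) * P powr (- H * (2 * real q + 1))
    \<le> 576 * P powr (- (H + 1/4)) * d powr (- (2 * H - 1/2))"
proof (cases "m = 0")
  case True
  then show ?thesis using q by (simp add: power_0_left)
next
  case False
  define p where "p = (H - 1/4) / (1 - H)"
  have p: "0 \<le> p" "p \<le> 2" "p * (1 - H) = H - 1/4"
    using H by (auto simp: p_def field_simps)
  have pq: "p \<le> 2 * real q - 1" using p q by simp
  have "m ^ (2 * q - 1) = m powr (2 * real q - 1)"
    using False m q by (simp add: powr_realpow[symmetric] of_nat_diff)
  also have "\<dots> = m powr p * m powr (2 * real q - 1 - p)"
    by (simp flip: powr_add)
  also have "\<dots> \<le> (24 * P * d powr (2 * H - 2)) powr p * (P powr H) powr (2 * real q - 1 - p)"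
    using m p pq CS A1 by (intro mult_mono powr_mono2) auto
  also have "(24 * P * d powr (2 * H - 2)) powr p = 24 powr p * P powr p * d powr ((2 * H - 2) * p)"
    using P d by (simp add: powr_mult powr_powr)
  also have "(2 * H - 2) * p = - (2 * H - 1/2)" using p(3) by (simp add: algebra_simps)
  finally have "m ^ (2 * q - 1) * P powr (- H * (2 * real q + 1))
      \<le> 24 powr p * P powr p * d powr (- (2 * H - 1/2)) * (P powr H) powr (2 * real q - 1 - p)
        * P powr (- H * (2 * real q + 1))"
    by (intro mult_right_mono) auto
  also have "\<dots> = 24 powr p * d powr (- (2 * H - 1/2))
      * P powr (p + H * (2 * real q - 1 - p) + (- H * (2 * real q + 1)))"
    by (simp only: powr_powr powr_add mult_ac)
  also have "p + H * (2 * real q - 1 - p) + (- H * (2 * real q + 1)) = - (H + 1/4)"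
    using p(3) by (simp add: algebra_simps)
  also have "24 powr p * d powr (- (2 * H - 1/2)) * P powr (- (H + 1/4))
      \<le> 24 powr 2 * d powr (- (2 * H - 1/2)) * P powr (- (H + 1/4))"
    using p by (intro mult_right_mono powr_mono) auto
  finally show ?thesis by (simp add: mult_ac)
qed

section \<open>Integrals in Hilbert spaces\<close>

lemma subspace_closure:
  fixes S :: "'a::real_normed_vector set"
  assumes "subspace S"
  shows "subspace (closure S)"
proof (rule subspaceI)
  show "0 \<in> closure S" using assms closure_subset subspace_0 by blast
next
  fix x y assume "x \<in> closure S" "y \<in> closure S"
  then obtain f g where "\<forall>n. f n \<in> S" "f \<longlonglongrightarrow> x" "\<forall>n. g n \<in> S" "g \<longlonglongrightarrow> y"
    unfolding closure_sequential by blast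
  then have "\<forall>n. f n + g n \<in> S" "(\<lambda>n. f n + g n) \<longlonglongrightarrow> x + y"
    using assms by (auto intro: subspace_add tendsto_add)
  then show "x + y \<in> closure S"
    unfolding closure_sequential by (intro exI[of _ "\<lambda>n. f n + g n"]) auto
next
  fix c x assume "x \<in> closure S"
  then obtain f where "\<forall>n. f n \<in> S" "f \<longlonglongrightarrow> x"
    unfolding closure_sequential by blast
  then have "\<forall>n. c *\<^sub>R f n \<in> S" "(\<lambda>n. c *\<^sub>R f n) \<longlonglongrightarrow> c *\<^sub>R x"
    using assms by (auto intro: subspace_scale tendsto_intros)
  then show "c *\<^sub>R x \<in> closure S"
    unfolding closure_sequential by (intro exI[of _ "\<lambda>n. c *\<^sub>R f n"]) auto
qed

text \<open>Subtracting the best multiple of \<open>s\<close> lowers the squared norm of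
  \<open>r\<close> by \<open>(r \<bullet> s)\<^sup>2 / (s \<bullet> s)\<close>, and near minimality
  allows a drop of at most \<open>\<delta>\<^sup>2\<close>.\<close>

lemma near_minimizer_almost_orthogonal:
  fixes r s :: "'a::real_inner"
  assumes min: "\<And>c. d\<^sup>2 \<le> (norm (r - c *\<^sub>R s))\<^sup>2" and r: "(norm r)\<^sup>2 \<le> d\<^sup>2 + \<delta>\<^sup>2" and "0 \<le> \<delta>"
  shows "\<bar>r \<bullet> s\<bar> \<le> \<delta> * norm s"
proof (cases "s = 0")
  case False
  then have s: "s \<bullet> s > 0" by simp
  define c where "c = (r \<bullet> s) / (s \<bullet> s)"
  have "(norm (r - c *\<^sub>R s))\<^sup>2 = (norm r)\<^sup>2 - 2 * c * (r \<bullet> s) + c * (c * (s \<bullet> s))"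
    by (simp add: power2_norm_eq_inner inner_diff inner_commute algebra_simps)
  also have "\<dots> = (norm r)\<^sup>2 - (r \<bullet> s)\<^sup>2 / (s \<bullet> s)"
    using s by (simp add: c_def power2_eq_square)
  finally have "(r \<bullet> s)\<^sup>2 / (s \<bullet> s) \<le> \<delta>\<^sup>2"
    using min[of c] r by simp
  then have "(r \<bullet> s)\<^sup>2 \<le> (\<delta> * norm s)\<^sup>2"
    using s by (simp add: divide_le_eq power_mult_distrib power2_norm_eq_inner)
  then show ?thesis
    using \<open>0 \<le> \<delta>\<close> abs_le_square_iff[of "r \<bullet> s" "\<delta> * norm s"] by simp
qed simp

text \<open>Otherwise the integral has distance \<open>d > 0\<close> from \<open>S\<close>. The
  residual \<open>r\<close> of an almost nearest point \<open>y\<close> is almost orthogonal to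
  \<open>S\<close>, hence to all values of \<open>f\<close> and so to the integral, and also to
  \<open>y\<close>. But the difference of these two inner products is
  \<open>(norm r)\<^sup>2 \<ge> d\<^sup>2\<close>.\<close>

lemma integral_in_closed_subspace:
  fixes f :: "'a \<Rightarrow> 'b::{real_inner,banach,second_countable_topology}"
  assumes "closed S" "subspace S" and f: "integrable M f" and fS: "\<And>z. f z \<in> S"
  shows "integral\<^sup>L M f \<in> S"
proof (rule ccontr)
  let ?x = "integral\<^sup>L M f"
  assume "?x \<notin> S"
  define d where "d = infdist ?x S"
  have ne: "S \<noteq> {}" using fS by auto
  have d: "d > 0"
    using \<open>?x \<notin> S\<close> \<open>closed S\<close> ne unfolding d_def by (simp add: infdist_pos_not_in_closed)
  \<comment> \<open>\<open>C\<close> adds up the sizes of what \<open>r\<close> is tested against: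
    the mean norm of \<open>f\<close>, and the norm of \<open>y\<close>, which is at most
    \<open>norm ?x + d + 1\<close> once \<open>\<delta> \<le> 1\<close>. The contradiction at the
    end is \<open>d\<^sup>2 \<le> \<delta> * C\<close>.\<close>
  define C where "C = (\<integral>z. norm (f z) \<partial>M) + norm ?x + d + 1"
  have C: "C > 0" using d by (simp add: C_def add_nonneg_pos)
  define \<delta> where "\<delta> = min 1 (d\<^sup>2 / (2 * C))"
  have \<delta>: "0 < \<delta>" "\<delta> \<le> 1" "\<delta> * C < d\<^sup>2"
  proof -
    have "\<delta> * C \<le> d\<^sup>2 / (2 * C) * C" using C by (intro mult_right_mono) (auto simp: \<delta>_def)
    also have "\<dots> < d\<^sup>2" using C d by simp
    finally show "\<delta> * C < d\<^sup>2" .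
  qed (use C d in \<open>auto simp: \<delta>_def\<close>)
  have "infdist ?x S < sqrt (d\<^sup>2 + \<delta>\<^sup>2)"
    using d \<delta> unfolding d_def[symmetric] by (intro real_less_rsqrt) simp
  then obtain y where y: "y \<in> S" "dist ?x y < sqrt (d\<^sup>2 + \<delta>\<^sup>2)"
    using ne by (auto simp: infdist_def cINF_less_iff split: if_splits)
  define r where "r = ?x - y"
  have r: "norm r < sqrt (d\<^sup>2 + \<delta>\<^sup>2)" using y by (simp add: r_def dist_norm)
  then have r2: "(norm r)\<^sup>2 \<le> d\<^sup>2 + \<delta>\<^sup>2"
    using power_mono[of "norm r" "sqrt (d\<^sup>2 + \<delta>\<^sup>2)" 2] by simp
  have dist: "d \<le> norm (r - s)" if "s \<in> S" for s
    using infdist_le[of "y + s" S ?x] that y \<open>subspace S\<close>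
    by (simp add: d_def r_def dist_norm subspace_add diff_diff_eq)
  have orth: "\<bar>r \<bullet> s\<bar> \<le> \<delta> * norm s" if "s \<in> S" for s
    using that dist d \<delta> r2 \<open>subspace S\<close>
    by (intro near_minimizer_almost_orthogonal[of d]) (auto intro!: power_mono simp: subspace_scale)
  have "r \<bullet> ?x = (\<integral>z. r \<bullet> f z \<partial>M)" using f by simp
  also have "\<dots> \<le> (\<integral>z. \<delta> * norm (f z) \<partial>M)"
    using f fS orth by (intro integral_mono) (auto intro: order_trans[OF abs_ge_self])
  finally have rx: "r \<bullet> ?x \<le> \<delta> * (\<integral>z. norm (f z) \<partial>M)" by simp
  have "norm r \<le> d + \<delta>"
    using r sqrt_add_le_add_sqrt[of "d\<^sup>2" "\<delta>\<^sup>2"] d \<delta> by simp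
  then have "norm y \<le> norm ?x + d + 1"
    using norm_triangle_ineq4[of ?x r] \<delta> by (simp add: r_def)
  then have ry: "- (r \<bullet> y) \<le> \<delta> * (norm ?x + d + 1)"
    using orth[OF y(1)] \<delta> mult_left_mono[of "norm y" "norm ?x + d + 1" \<delta>] by linarith
  have "d\<^sup>2 \<le> (norm r)\<^sup>2"
    using dist[OF subspace_0[OF \<open>subspace S\<close>]] d by (intro power_mono) auto
  also have "\<dots> = r \<bullet> ?x + - (r \<bullet> y)"
    by (simp add: power2_norm_eq_inner r_def inner_diff inner_commute)
  also have "\<dots> \<le> \<delta> * C" using rx ry by (simp add: C_def algebra_simps)
  finally show False using \<delta> by simp
qed

text \<open>The integral is paired with itself and the inner product is moved inside in each slot.
  Unlike a bound by the integral of \<open>norm (g x)\<close>, this keeps the smallness of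
  \<open>g x \<bullet> g y\<close> for nearly orthogonal values.\<close>

lemma norm_integral_square_le:
  fixes g :: "'a \<Rightarrow> 'b::{real_inner,banach,second_countable_topology}"
  assumes g: "integrable M g"
  shows "ennreal ((norm (integral\<^sup>L M g))\<^sup>2)
    \<le> (\<integral>\<^sup>+x. (\<integral>\<^sup>+y. ennreal \<bar>g x \<bullet> g y\<bar> \<partial>M) \<partial>M)"
proof -
  let ?v = "integral\<^sup>L M g"
  have "(norm ?v)\<^sup>2 = norm (\<integral>x. g x \<bullet> ?v \<partial>M)"
    using g by (simp add: power2_norm_eq_inner)
  also have "ennreal \<dots> \<le> (\<integral>\<^sup>+x. ennreal (norm (g x \<bullet> ?v)) \<partial>M)"
    by (intro integral_norm_bound_ennreal integrable_inner_left g)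
  also have "\<dots> \<le> (\<integral>\<^sup>+x. (\<integral>\<^sup>+y. ennreal \<bar>g x \<bullet> g y\<bar> \<partial>M) \<partial>M)"
  proof (rule nn_integral_mono)
    fix x
    have "g x \<bullet> ?v = (\<integral>y. g x \<bullet> g y \<partial>M)" using g by simp
    then show "ennreal (norm (g x \<bullet> ?v)) \<le> (\<integral>\<^sup>+y. ennreal \<bar>g x \<bullet> g y\<bar> \<partial>M)"
      using g integral_norm_bound_ennreal[of M "\<lambda>y. g x \<bullet> g y"] by simp
  qed
  finally show ?thesis .
qed

text \<open>Expanding \<open>(norm (\<Phi> x - \<Phi> a))\<^sup>2\<close> leaves only inner
  products, which are the explicit data about tensor powers of indicators.\<close>

lemma continuous_on_if_continuous_inner:
  fixes \<Phi> :: "'a::topological_space \<Rightarrow> 'b::real_inner"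
  assumes diag: "continuous_on S (\<lambda>x. \<Phi> x \<bullet> \<Phi> x)"
    and off: "\<And>a. a \<in> S \<Longrightarrow> continuous_on S (\<lambda>x. \<Phi> x \<bullet> \<Phi> a)"
  shows "continuous_on S \<Phi>"
  unfolding continuous_on_def
proof
  fix a assume a: "a \<in> S"
  have "((\<lambda>x. \<Phi> x \<bullet> \<Phi> x - 2 * (\<Phi> x \<bullet> \<Phi> a) + \<Phi> a \<bullet> \<Phi> a) \<longlongrightarrow>
      \<Phi> a \<bullet> \<Phi> a - 2 * (\<Phi> a \<bullet> \<Phi> a) + \<Phi> a \<bullet> \<Phi> a) (at a within S)"
    using diag off[OF a] a unfolding continuous_on_def 
    by (intro tendsto_add tendsto_diff tendsto_mult_left tendsto_const) auto
  moreover have "\<Phi> x \<bullet> \<Phi> x - 2 * (\<Phi> x \<bullet> \<Phi> a) + \<Phi> a \<bullet> \<Phi> a = (norm (\<Phi> x - \<Phi> a))\<^sup>2" for x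
    by (simp add: power2_norm_eq_inner inner_diff inner_commute)
  ultimately have "((\<lambda>x. (norm (\<Phi> x - \<Phi> a))\<^sup>2) \<longlongrightarrow> 0) (at a within S)" by simp
  from tendsto_real_sqrt[OF this] have "((\<lambda>x. norm (\<Phi> x - \<Phi> a)) \<longlongrightarrow> 0) (at a within S)" by simp
  then show "(\<Phi> \<longlongrightarrow> \<Phi> a) (at a within S)"
    by (subst LIM_zero_iff[symmetric]) (simp add: tendsto_norm_zero_iff)
qed

section \<open>Domination of the kernels\<close>

text \<open>The value at the singularity is \<open>\<infinity>\<close> because \<open>0 powr a = 0\<close> would break pointwise domination.\<close>

definition riesz_kernel :: "real \<Rightarrow> real \<Rightarrow> ennreal" where
  "riesz_kernel c v = (if v = 0 then \<infinity> else ennreal (\<bar>v\<bar> powr - c))"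

lemma measurable_riesz_kernel [measurable]: "riesz_kernel c \<in> borel_measurable borel"
  unfolding riesz_kernel_def by measurable

lemma riesz_kernel_minus: "riesz_kernel c (- v) = riesz_kernel c v"
  by (simp add: riesz_kernel_def)

text \<open>For \<open>s\<close> in \<open>{0..T}\<close> the shifted variable \<open>t - s\<close>
  stays in \<open>{-T..T}\<close>, which makes the bound uniform in \<open>s\<close>; each half of
  that interval contributes \<open>J\<close>.\<close>

lemma riesz_kernel_integral_bound:
  assumes "c < 1" "0 \<le> T"
  obtains K where "K < \<infinity>"
    "\<And>s. s \<in> {0..T} \<Longrightarrow> (\<integral>\<^sup>+t. indicator {0..T} t * riesz_kernel c (t - s) \<partial>lborel) \<le> K"
proof -
  define J where "J = (\<integral>\<^sup>+v. ennreal (v powr - c) * indicator {0..T} v \<partial>lborel)"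
  have "((\<lambda>v. v powr - c) has_integral (T powr (- c + 1) / (- c + 1))) {0..T}"
    using assms by (intro has_integral_powr_from_0) auto
  then have "J = ennreal (T powr (- c + 1) / (- c + 1))"
    unfolding J_def by (intro nn_integral_has_integral_lebesgue') auto
  then have J: "J < \<infinity>" by simp
  have J': "(\<integral>\<^sup>+v. ennreal ((- v) powr - c) * indicator {0..T} (- v) \<partial>lborel) = J"
    unfolding J_def
    by (subst (2) nn_integral_real_affine[where c = "-1" and t = 0]) auto
  show thesis
  proof (rule that[of "J + J"])
    show "J + J < \<infinity>" using J by simp
    fix s assume s: "s \<in> {0..T}"
    have "(\<integral>\<^sup>+t. indicator {0..T} t * riesz_kernel c (t - s) \<partial>lborel)
        \<le> (\<integral>\<^sup>+t. indicator {-T..T} (t - s) * riesz_kernel c (t - s) \<partial>lborel)"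
      using s by (intro nn_integral_mono mult_right_mono) (auto simp: indicator_def)
    also have "\<dots> = (\<integral>\<^sup>+v. indicator {-T..T} v * riesz_kernel c v \<partial>lborel)"
      by (subst (2) nn_integral_real_affine[where c = 1 and t = "- s"]) auto
    also have "\<dots> \<le> (\<integral>\<^sup>+v. ennreal (v powr - c) * indicator {0..T} v
        + ennreal ((- v) powr - c) * indicator {0..T} (- v) \<partial>lborel)"
    proof (rule nn_integral_mono_AE)
      show "AE v in lborel. indicator {-T..T} v * riesz_kernel c v
          \<le> ennreal (v powr - c) * indicator {0..T} v
            + ennreal ((- v) powr - c) * indicator {0..T} (- v)"
        \<comment> \<open>At the origin the left-hand side is infinite and the right-hand side is 0,
          so the inequality holds only almost everywhere.\<close>
        using AE_lborel_singleton[of 0]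
      proof eventually_elim
        case (elim v)
        then show ?case by (cases "v > 0") (auto simp: riesz_kernel_def indicator_def)
      qed
    qed
    also have "\<dots> = J + J"
      by (subst nn_integral_add) (auto simp: J' J_def[symmetric])
    finally show "(\<integral>\<^sup>+t. indicator {0..T} t * riesz_kernel c (t - s) \<partial>lborel) \<le> J + J" .
  qed
qed

text \<open>With \<open>x = (s, t)\<close> and \<open>y = (u, v)\<close>, the order
  \<open>v\<close>, \<open>u\<close>, \<open>t\<close>, \<open>s\<close> meets at most one remaining
  singular factor at a time. The successive integrations contribute \<open>K\<close>,
  \<open>L\<close>, \<open>K\<close> and \<open>T\<close>.\<close>

lemma riesz_kernel_product_integral_finite:
  assumes "b < 1" "c < 1" "0 \<le> T"
  shows "(\<integral>\<^sup>+x. (\<integral>\<^sup>+y. indicator ({0..T} \<times> {0..T}) x * indicator ({0..T} \<times> {0..T}) y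
      * (riesz_kernel c (snd x - fst x) * riesz_kernel c (snd y - fst y)
        * riesz_kernel b (fst x - fst y)) \<partial>lborel) \<partial>lborel) < \<infinity>"
    (is "(\<integral>\<^sup>+x. (\<integral>\<^sup>+y. ?G x y \<partial>lborel) \<partial>lborel) < \<infinity>")
proof -
  let ?i = "indicator {0..T} :: real \<Rightarrow> ennreal"
  obtain K where K: "K < \<infinity>"
    "\<And>s. s \<in> {0..T} \<Longrightarrow> (\<integral>\<^sup>+t. ?i t * riesz_kernel c (t - s) \<partial>lborel) \<le> K"
    using riesz_kernel_integral_bound assms by blast
  obtain L where L: "L < \<infinity>"
    "\<And>s. s \<in> {0..T} \<Longrightarrow> (\<integral>\<^sup>+t. ?i t * riesz_kernel b (t - s) \<partial>lborel) \<le> L"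
    using riesz_kernel_integral_bound assms by blast
  have K': "?i s * (\<integral>\<^sup>+t. ?i t * riesz_kernel c (t - s) \<partial>lborel) \<le> ?i s * K" for s
    using K(2)[of s] by (auto simp: indicator_def)
  have i2: "indicator ({0..T} \<times> {0..T}) (s, t) = ?i s * ?i t" for s t
    by (simp add: indicator_def)
  have inner: "(\<integral>\<^sup>+y. ?G x y \<partial>lborel)
      \<le> ?i (fst x) * ?i (snd x) * riesz_kernel c (snd x - fst x) * (K * L)" for x
  proof (cases x)
    case (Pair s t)
    have "(\<integral>\<^sup>+y. ?G x y \<partial>lborel) = (\<integral>\<^sup>+u. (\<integral>\<^sup>+v. ?G x (u, v) \<partial>lborel) \<partial>lborel)"
      by (subst lborel_prod[symmetric], subst lborel.nn_integral_fst[symmetric]) auto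
    also have "\<dots> = (\<integral>\<^sup>+u. ?i s * ?i t * riesz_kernel c (t - s) * (riesz_kernel b (u - s)
        * (?i u * (\<integral>\<^sup>+v. ?i v * riesz_kernel c (v - u) \<partial>lborel))) \<partial>lborel)"
      using riesz_kernel_minus[of b "s - _"]
      by (simp add: Pair i2 mult_ac flip: nn_integral_cmult)
    also have "\<dots> \<le> (\<integral>\<^sup>+u. ?i s * ?i t * riesz_kernel c (t - s) * (riesz_kernel b (u - s)
        * (?i u * K)) \<partial>lborel)"
      by (intro nn_integral_mono mult_left_mono K') auto
    also have "\<dots> = ?i t * riesz_kernel c (t - s) * K
        * (?i s * (\<integral>\<^sup>+u. ?i u * riesz_kernel b (u - s) \<partial>lborel))"
      by (simp add: mult_ac flip: nn_integral_cmult)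
    also have "\<dots> \<le> ?i t * riesz_kernel c (t - s) * K * (?i s * L)"
      using L(2)[of s] by (cases "s \<in> {0..T}") (auto intro!: mult_left_mono)
    finally show ?thesis by (simp add: Pair mult_ac)
  qed
  have "(\<integral>\<^sup>+x. (\<integral>\<^sup>+y. ?G x y \<partial>lborel) \<partial>lborel)
      \<le> (\<integral>\<^sup>+x. ?i (fst x) * ?i (snd x) * riesz_kernel c (snd x - fst x) * (K * L)
        \<partial>(lborel :: (real \<times> real) measure))"
    by (intro nn_integral_mono inner)
  also have "\<dots> = (\<integral>\<^sup>+s. (\<integral>\<^sup>+t. ?i s * ?i t * riesz_kernel c (t - s) * (K * L) \<partial>lborel) \<partial>lborel)"
    by (subst lborel_prod[symmetric], subst lborel.nn_integral_fst[symmetric]) auto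
  also have "\<dots> = (\<integral>\<^sup>+s. K * L * (?i s * (\<integral>\<^sup>+t. ?i t * riesz_kernel c (t - s) \<partial>lborel)) \<partial>lborel)"
    by (simp add: mult_ac flip: nn_integral_cmult)
  also have "\<dots> \<le> (\<integral>\<^sup>+s. K * L * (?i s * K) \<partial>lborel)"
    by (intro nn_integral_mono mult_left_mono K') auto
  also have "\<dots> = K * L * K * ennreal T"
    using assms by (simp add: nn_integral_cmult nn_integral_multc mult_ac)
  also have "\<dots> < \<infinity>" using K L by (simp add: ennreal_mult_less_top)
  finally show ?thesis .
qed

section \<open>The defect of the regularised weights: majorant and limit\<close>

definition triangle :: "real \<Rightarrow> (real \<times> real) set" where
  "triangle T = {(s, t). 0 \<le> s \<and> s \<le> t \<and> t \<le> T}"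

definition kernel_weight :: "real \<Rightarrow> nat \<Rightarrow> real \<Rightarrow> real \<times> real \<Rightarrow> real" where
  "kernel_weight H q \<epsilon> z = (\<epsilon> + (snd z - fst z) powr (2 * H)) powr (- real q - 1 / 2)"

text \<open>For \<open>0 < \<eta> \<le> \<epsilon>\<close> this dominates, up to a constant, the
  inner products between values of the difference of the integrands at \<open>\<eta>\<close> and
  \<open>\<epsilon>\<close>. The exponent \<open>2 * q - 1\<close> is odd, hence the absolute
  value.\<close>

definition defect_density :: "real \<Rightarrow> real \<Rightarrow> nat \<Rightarrow> real \<Rightarrow> real \<times> real \<Rightarrow> real \<times> real \<Rightarrow> real" where
  "defect_density T H q \<epsilon> x y = indicator (triangle T) x * indicator (triangle T) y *
     ((kernel_weight H q 0 x - kernel_weight H q \<epsilon> x)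
       * (kernel_weight H q 0 y - kernel_weight H q \<epsilon> y) * \<bar>increment_cov H x y\<bar> ^ (2 * q - 1))"

definition defect :: "real \<Rightarrow> real \<Rightarrow> nat \<Rightarrow> real \<Rightarrow> ennreal" where
  "defect T H q \<epsilon> = (\<integral>\<^sup>+x. (\<integral>\<^sup>+y. ennreal (defect_density T H q \<epsilon> x y) \<partial>lborel) \<partial>lborel)"

lemma triangle_iff: "x \<in> triangle T \<longleftrightarrow> 0 \<le> fst x \<and> fst x \<le> snd x \<and> snd x \<le> T"
  by (cases x) (simp add: triangle_def)

lemma compact_triangle: "compact (triangle T)"
proof -
  have eq: "triangle T = {x. 0 \<le> fst x} \<inter> {x. fst x \<le> snd x} \<inter> {x. snd x \<le> T}"
    by (auto simp: triangle_iff)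
  have "closed (triangle T)"
    unfolding eq by (intro closed_Int closed_Collect_le continuous_intros)
  moreover have "triangle T \<subseteq> {0..T} \<times> {0..T}" by (auto simp: triangle_iff)
  then have "bounded (triangle T)"
    by (rule bounded_subset[rotated]) (intro bounded_Times bounded_closed_interval)
  ultimately show ?thesis by (simp add: compact_eq_bounded_closed)
qed

lemma measurable_triangle [measurable]: "triangle T \<in> sets borel"
  using compact_triangle borel_compact by blast

lemma measurable_kernel_weight [measurable]: "kernel_weight H q \<epsilon> \<in> borel_measurable borel"
  unfolding kernel_weight_def borel_prod[symmetric] by measurable

text \<open>The strict inequality matters: on the diagonal the weight at 0 is 0, because
  \<open>0 powr a = 0\<close>, while it is positive for \<open>\<epsilon> > 0\<close>.\<close>

lemma kernel_weight_antimono: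
  assumes "fst z < snd z" "0 \<le> \<delta>" "\<delta> \<le> \<epsilon>"
  shows "kernel_weight H q \<epsilon> z \<le> kernel_weight H q \<delta> z"
  unfolding kernel_weight_def using assms by (intro powr_mono2') (auto simp: add_nonneg_pos)

lemma kernel_weight_nonneg: "0 \<le> kernel_weight H q \<epsilon> z"
  by (simp add: kernel_weight_def)

text \<open>This makes the diagonal harmless, where the weights are neither monotone nor convergent
  as \<open>\<epsilon>\<close> tends to 0.\<close>

lemma increment_cov_degenerate:
  "fst x = snd x \<Longrightarrow> increment_cov H x y = 0" "fst y = snd y \<Longrightarrow> increment_cov H x y = 0"
  by (auto simp: increment_cov_def)

text \<open>Each weight gap is at most the weight at 0, and the two weights at 0 multiply to the
  power of \<open>P = h * k\<close> in \<open>power_kernel_le\<close>. Degenerate intervals, where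
  the density vanishes, and equal left ends, where the majorant is infinite, are treated
  apart.\<close>

lemma defect_density_le_riesz:
  assumes H: "2/3 < H" "H < 3/4" and q: "2 \<le> q" and \<epsilon>: "0 \<le> \<epsilon>"
    and CS: "\<And>x y. x \<in> triangle T \<Longrightarrow> y \<in> triangle T \<Longrightarrow>
      \<bar>increment_cov H x y\<bar> \<le> ((snd x - fst x) * (snd y - fst y)) powr H"
  shows "ennreal (defect_density T H q \<epsilon> x y)
    \<le> 576 * (indicator ({0..T} \<times> {0..T}) x * indicator ({0..T} \<times> {0..T}) y
      * (riesz_kernel (H + 1/4) (snd x - fst x) * riesz_kernel (H + 1/4) (snd y - fst y)
        * riesz_kernel (2 * H - 1/2) (fst x - fst y)))"
proof (cases "x \<in> triangle T \<and> y \<in> triangle T \<and> fst x < snd x \<and> fst y < snd y")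
  case False
  then have "defect_density T H q \<epsilon> x y = 0"
    using q increment_cov_degenerate[of x H y] increment_cov_degenerate[of y H x]
    by (auto simp: defect_density_def triangle_iff power_0_left indicator_def)
  then show ?thesis by simp
next
  case True
  define h k d m where "h = snd x - fst x" "k = snd y - fst y" "d = \<bar>fst x - fst y\<bar>"
    and "m = \<bar>increment_cov H x y\<bar>"
  note hkd = this
  have pos: "0 < h" "0 < k" "0 \<le> m" using True by (auto simp: hkd)
  have ind: "x \<in> {0..T} \<times> {0..T}" "y \<in> {0..T} \<times> {0..T}"
    using True by (auto simp: triangle_iff mem_Times_iff)
  have main: "defect_density T H q \<epsilon> x y
      \<le> 576 * (h powr (- (H + 1/4)) * k powr (- (H + 1/4)) * d powr (- (2 * H - 1/2)))"
    if d: "d \<noteq> 0"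
  proof -
    have "defect_density T H q \<epsilon> x y
        \<le> kernel_weight H q 0 x * kernel_weight H q 0 y * m ^ (2 * q - 1)"
      unfolding defect_density_def hkd(4)[symmetric]
      using True pos \<epsilon> kernel_weight_antimono[of x 0 \<epsilon> H q] kernel_weight_antimono[of y 0 \<epsilon> H q]
      by (auto intro!: mult_right_mono mult_mono simp: kernel_weight_nonneg)
    also have "kernel_weight H q 0 x * kernel_weight H q 0 y
        = (h * k) powr (- H * (2 * real q + 1))"
    proof -
      have "2 * H * (- real q - 1 / 2) = - H * (2 * real q + 1)" by (simp add: algebra_simps)
      then show ?thesis
        unfolding kernel_weight_def hkd(1,2)[symmetric] by (simp only: powr_powr powr_mult add_0)
    qed
    also have "\<dots> * m ^ (2 * q - 1) = m ^ (2 * q - 1) * (h * k) powr (- H * (2 * real q + 1))"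
      by (rule mult.commute)
    also have "\<dots> \<le> 576 * (h * k) powr (- (H + 1/4)) * d powr (- (2 * H - 1/2))"
    proof (rule power_kernel_le[OF H q])
      show "0 < h * k" "0 < d" "0 \<le> m" using pos d by (auto simp: hkd)
      show "m \<le> (h * k) powr H" using CS True by (simp add: hkd)
      show "m \<le> 24 * (h * k) * d powr (2 * H - 2)"
        using increment_cov_le[of H "fst x" "snd x" "fst y" "snd y"] CS[of x y] True H d
        by (simp add: hkd algebra_simps)
    qed
    finally show ?thesis by (simp add: powr_mult mult_ac)
  qed
  show ?thesis
  proof (cases "d = 0")
    case True
    then have "riesz_kernel (2 * H - 1/2) (fst x - fst y) = \<infinity>"
      by (simp add: riesz_kernel_def hkd)
    moreover have "riesz_kernel (H + 1/4) h \<noteq> 0" "riesz_kernel (H + 1/4) k \<noteq> 0"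
      using pos by (auto simp: riesz_kernel_def)
    ultimately show ?thesis
      using ind by (simp add: hkd ennreal_mult_top ennreal_mult_eq_top_iff)
  next
    case False
    then have "riesz_kernel (2 * H - 1/2) (fst x - fst y) = ennreal (d powr (- (2 * H - 1/2)))"
        "riesz_kernel (H + 1/4) (snd x - fst x) = ennreal (h powr (- (H + 1/4)))"
        "riesz_kernel (H + 1/4) (snd y - fst y) = ennreal (k powr (- (H + 1/4)))"
      using pos by (auto simp: riesz_kernel_def hkd)
    then show ?thesis
      using ind ennreal_leI[OF main[OF False]] by (simp add: ennreal_mult mult_ac)
  qed
qed

lemma measurable_defect_density [measurable]:
  "(\<lambda>(x, y). defect_density T H q \<epsilon> x y) \<in> borel_measurable (lborel \<Otimes>\<^sub>M lborel)"
proof -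
  have *: "(\<lambda>z. increment_cov H (fst z) (snd z)) \<in>
      borel_measurable ((borel \<Otimes>\<^sub>M borel) \<Otimes>\<^sub>M (borel \<Otimes>\<^sub>M borel))"
    unfolding increment_cov_def by measurable
  have "sets ((lborel :: (real \<times> real) measure) \<Otimes>\<^sub>M (lborel :: (real \<times> real) measure))
      = sets ((borel \<Otimes>\<^sub>M borel) \<Otimes>\<^sub>M (borel \<Otimes>\<^sub>M borel))"
    by (intro sets_pair_measure_cong) (simp_all only: borel_prod sets_lborel)
  with * have [measurable]: "(\<lambda>z. increment_cov H (fst z) (snd z)) \<in>
      borel_measurable (lborel \<Otimes>\<^sub>M lborel)"
    by (simp cong: measurable_cong_sets)
  show ?thesis unfolding defect_density_def case_prod_beta by measurable
qed

text \<open>Dominated convergence: the majorant of \<open>defect_density_le_riesz\<close> does not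
  involve \<open>\<epsilon>\<close>, and \<open>H < 3/4\<close> makes all its exponents smaller than
  1.\<close>

lemma defect_tendsto_0:
  assumes T: "0 \<le> T" and H: "2/3 < H" "H < 3/4" and q: "2 \<le> q"
    and CS: "\<And>x y. x \<in> triangle T \<Longrightarrow> y \<in> triangle T \<Longrightarrow>
      \<bar>increment_cov H x y\<bar> \<le> ((snd x - fst x) * (snd y - fst y)) powr H"
    and e: "\<And>n. 0 \<le> e n" "e \<longlonglongrightarrow> 0"
  shows "(\<lambda>n. defect T H q (e n)) \<longlonglongrightarrow> 0"
proof -
  let ?w = "\<lambda>x y. 576 * (indicator ({0..T} \<times> {0..T}) x * indicator ({0..T} \<times> {0..T}) y
      * (riesz_kernel (H + 1/4) (snd x - fst x) * riesz_kernel (H + 1/4) (snd y - fst y)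
        * riesz_kernel (2 * H - 1/2) (fst x - fst y)))"
  let ?M = "lborel \<Otimes>\<^sub>M lborel :: ((real \<times> real) \<times> (real \<times> real)) measure"
  have [measurable]: "{0..T} \<times> {0..T} \<in> sets borel"
    by (intro borel_closed closed_Times) auto
  have [measurable]: "fst \<in> borel_measurable (borel :: (real \<times> real) measure)"
      "snd \<in> borel_measurable (borel :: (real \<times> real) measure)"
    by (auto intro!: borel_measurable_continuous_onI continuous_intros)
  have w: "(\<lambda>(x, y). ?w x y) \<in> borel_measurable ?M"
    unfolding case_prod_beta by measurable
  have iter: "(\<integral>\<^sup>+x. (\<integral>\<^sup>+y. f x y \<partial>lborel) \<partial>lborel) = (\<integral>\<^sup>+(x, y). f x y \<partial>?M)"
    if "(\<lambda>(x, y). f x y) \<in> borel_measurable ?M" for f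
    using lborel.nn_integral_fst[OF that] by simp
  have "(\<lambda>n. \<integral>\<^sup>+(x, y). ennreal (defect_density T H q (e n) x y) \<partial>?M) \<longlonglongrightarrow> (\<integral>\<^sup>+z. 0 \<partial>?M)"
  proof (rule nn_integral_dominated_convergence[OF _ _ w])
    show "(\<lambda>(x, y). ennreal (defect_density T H q (e n) x y)) \<in> borel_measurable ?M" for n
      using measurable_defect_density[of T H q "e n"] by (simp add: case_prod_beta)
    show "AE z in ?M. (case z of (x, y) \<Rightarrow> ennreal (defect_density T H q (e n) x y))
        \<le> (case z of (x, y) \<Rightarrow> ?w x y)" for n
      using defect_density_le_riesz[OF H q e(1) CS] by (intro AE_I2) (auto simp: case_prod_beta)
    have "(\<integral>\<^sup>+z. (case z of (x, y) \<Rightarrow> ?w x y) \<partial>?M)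
        = (\<integral>\<^sup>+x. (\<integral>\<^sup>+y. ?w x y \<partial>lborel) \<partial>lborel)"
      using iter[OF w] by simp
    also have "\<dots> < \<infinity>"
      using riesz_kernel_product_integral_finite[of "2 * H - 1/2" "H + 1/4" T] H T
      by (simp add: nn_integral_cmult ennreal_mult_less_top)
    finally show "(\<integral>\<^sup>+z. (case z of (x, y) \<Rightarrow> ?w x y) \<partial>?M) < \<infinity>" .
    have lim: "(\<lambda>n. defect_density T H q (e n) x y) \<longlonglongrightarrow> 0" for x y
    proof (cases "fst x < snd x \<and> fst y < snd y")
      case True
      have wlim: "(\<lambda>n. kernel_weight H q (e n) z) \<longlonglongrightarrow> kernel_weight H q 0 z"
        if "fst z < snd z" for z
        unfolding kernel_weight_def using that by (intro tendsto_intros e) auto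
      have "(\<lambda>n. defect_density T H q (e n) x y) \<longlonglongrightarrow>
          indicator (triangle T) x * indicator (triangle T) y *
          ((kernel_weight H q 0 x - kernel_weight H q 0 x)
            * (kernel_weight H q 0 y - kernel_weight H q 0 y) * \<bar>increment_cov H x y\<bar> ^ (2 * q - 1))"
        unfolding defect_density_def using True by (intro tendsto_intros wlim) auto
      then show ?thesis by simp
    next
      case False
      then have "defect_density T H q (e n) x y = 0" for n
        using q increment_cov_degenerate[of x H y] increment_cov_degenerate[of y H x]
        by (auto simp: defect_density_def triangle_iff power_0_left indicator_def)
      then show ?thesis by simp
    qed
    show "AE z in ?M. (\<lambda>n. case z of (x, y) \<Rightarrow> ennreal (defect_density T H q (e n) x y)) \<longlonglongrightarrow> 0"
      using tendsto_ennrealI[OF lim] by (intro AE_I2) (auto simp: case_prod_beta)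
  qed auto
  moreover have "defect T H q \<epsilon> = (\<integral>\<^sup>+(x, y). ennreal (defect_density T H q \<epsilon> x y) \<partial>?M)" for \<epsilon>
    unfolding defect_def using measurable_defect_density[of T H q \<epsilon>]
    by (intro iter) (simp add: case_prod_beta)
  ultimately show ?thesis by simp
qed

section \<open>Convergence\<close>

text \<open>Comparing with the single value \<open>f r\<close> suffices, since any two values below
  \<open>r\<close> are then close to each other. This form fits an estimate that is uniform in the
  smaller parameter.\<close>

lemma convergent_at_right_0I:
  fixes f :: "real \<Rightarrow> 'a::complete_space"
  assumes "\<And>\<delta>. 0 < \<delta> \<Longrightarrow> \<exists>r>0. \<forall>\<epsilon>. 0 < \<epsilon> \<and> \<epsilon> \<le> r \<longrightarrow> dist (f \<epsilon>) (f r) < \<delta>"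
  shows "\<exists>L. (f \<longlongrightarrow> L) (at_right 0)"
proof -
  have "cauchy_filter (filtermap f (at_right 0))"
    unfolding cauchy_filter_metric_filtermap
  proof (intro allI impI)
    fix \<delta> :: real assume "0 < \<delta>"
    then obtain r where r: "0 < r" "\<And>\<epsilon>. 0 < \<epsilon> \<and> \<epsilon> \<le> r \<Longrightarrow> dist (f \<epsilon>) (f r) < \<delta> / 2"
      using assms[of "\<delta> / 2"] by auto
    have "eventually (\<lambda>\<epsilon>. 0 < \<epsilon> \<and> \<epsilon> < r) (at_right 0)"
      using r(1) by (auto simp: eventually_at_right_field)
    moreover have "dist (f x) (f y) < \<delta>" if "0 < x \<and> x < r" "0 < y \<and> y < r" for x y
      using r(2)[of x] r(2)[of y] that dist_triangle_half_l[of "f x" "f r" \<delta> "f y"] by auto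
    ultimately show "\<exists>P. eventually P (at_right 0) \<and> (\<forall>x y. P x \<and> P y \<longrightarrow> dist (f x) (f y) < \<delta>)"
      by blast
  qed
  moreover have "filtermap f (at_right 0) \<noteq> bot" by (simp add: filtermap_bot_iff)
  ultimately obtain L where "filtermap f (at_right 0) \<le> nhds L"
    using complete_UNIV[where 'a = 'a] unfolding complete_uniform by (auto simp: top_unique)
  then show ?thesis by (auto simp: filterlim_def)
qed

section \<open>The Cauchy property of the regularised integrals\<close>

lemma continuous_on_increment_cov:
  assumes "0 < H" "continuous_on S f" "continuous_on S g"
  shows "continuous_on S (\<lambda>z. increment_cov H (f z) (g z))"
  unfolding increment_cov_def using assms
  by (intro continuous_intros continuous_on_powr') auto

lemma continuous_on_kernel_weight:
  assumes "0 < H" "0 < \<epsilon>"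
  shows "continuous_on (triangle T) (kernel_weight H q \<epsilon>)"
  unfolding kernel_weight_def using assms
  by (intro continuous_intros continuous_on_powr')
    (auto simp: triangle_iff add_pos_nonneg add_nonneg_eq_0_iff)

text \<open>In the application \<open>c\<close> is the signed coefficient and
  \<open>\<Phi> z\<close> the tensor power of an indicator. Leaving both abstract shows that the
  convergence depends on \<open>\<Phi>\<close> only through its inner products.\<close>

definition regularized ::
    "real \<Rightarrow> real \<Rightarrow> real \<Rightarrow> nat \<Rightarrow> (real \<times> real \<Rightarrow> 'k::real_vector) \<Rightarrow> real \<Rightarrow> real \<times> real \<Rightarrow> 'k" where
  "regularized T H c q \<Phi> \<epsilon> z =
     indicator (triangle T) z *\<^sub>R ((c * kernel_weight H q \<epsilon> z) *\<^sub>R \<Phi> z)"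

context
  fixes T H c :: real and q :: nat
    and \<Phi> :: "real \<times> real \<Rightarrow> 'k::{real_inner,banach,second_countable_topology}"
  assumes T: "0 \<le> T" and H: "2/3 < H" "H < 3/4" and q: "2 \<le> q"
    and inner: "\<And>x y. x \<in> triangle T \<Longrightarrow> y \<in> triangle T \<Longrightarrow>
      \<Phi> x \<bullet> \<Phi> y = increment_cov H x y ^ (2 * q - 1)"
    and CS: "\<And>x y. x \<in> triangle T \<Longrightarrow> y \<in> triangle T \<Longrightarrow>
      \<bar>increment_cov H x y\<bar> \<le> ((snd x - fst x) * (snd y - fst y)) powr H"
begin

abbreviation "reg \<equiv> regularized T H c q \<Phi>"

text \<open>A positive \<open>\<epsilon>\<close> removes the singularity of the weight, so the
  integrand is continuous on a compact set.\<close>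

lemma integrable_regularized:
  assumes "0 < \<epsilon>"
  shows "integrable lborel (reg \<epsilon>)"
proof -
  have off: "continuous_on (triangle T) (\<lambda>x. \<Phi> x \<bullet> \<Phi> a)" if "a \<in> triangle T" for a
  proof (rule continuous_on_eq)
    show "continuous_on (triangle T) (\<lambda>x. increment_cov H x a ^ (2 * q - 1))"
      using H by (intro continuous_on_power continuous_on_increment_cov continuous_on_id
          continuous_on_const) auto
  qed (simp add: inner that)
  have diag: "continuous_on (triangle T) (\<lambda>x. \<Phi> x \<bullet> \<Phi> x)"
  proof (rule continuous_on_eq)
    show "continuous_on (triangle T) (\<lambda>x. increment_cov H x x ^ (2 * q - 1))"
      using H by (intro continuous_on_power continuous_on_increment_cov continuous_on_id) auto
  qed (simp add: inner)
  have "continuous_on (triangle T) \<Phi>"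
    by (rule continuous_on_if_continuous_inner[OF diag off])
  then show ?thesis
    unfolding regularized_def using H assms
    by (intro borel_integrable_compact compact_triangle continuous_on_scaleR
        continuous_on_mult_left continuous_on_kernel_weight) auto
qed

text \<open>Off the diagonal, monotonicity puts the gap between the weights at \<open>\<eta>\<close>
  and \<open>\<epsilon>\<close> between 0 and the gap for the weight at 0. The right-hand side is
  therefore free of \<open>\<eta>\<close>.\<close>

lemma norm_regularized_integral_diff:
  assumes "0 < \<eta>" "\<eta> \<le> \<epsilon>"
  shows "ennreal ((norm (integral\<^sup>L lborel (reg \<eta>) - integral\<^sup>L lborel (reg \<epsilon>)))\<^sup>2)
    \<le> ennreal (c\<^sup>2) * defect T H q \<epsilon>"
proof -
  define g where "g z = reg \<eta> z - reg \<epsilon> z" for z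
  have "integral\<^sup>L lborel (reg \<eta>) - integral\<^sup>L lborel (reg \<epsilon>) = integral\<^sup>L lborel g"
    unfolding g_def using assms integrable_regularized by (subst Bochner_Integration.integral_diff) auto
  moreover have "integrable lborel g"
    unfolding g_def using assms integrable_regularized by auto
  ultimately have "ennreal ((norm (integral\<^sup>L lborel (reg \<eta>) - integral\<^sup>L lborel (reg \<epsilon>)))\<^sup>2)
      \<le> (\<integral>\<^sup>+x. (\<integral>\<^sup>+y. ennreal \<bar>g x \<bullet> g y\<bar> \<partial>lborel) \<partial>lborel)"
    using norm_integral_square_le by metis
  also have "\<dots> \<le> (\<integral>\<^sup>+x. (\<integral>\<^sup>+y. ennreal (c\<^sup>2) * ennreal (defect_density T H q \<epsilon> x y) \<partial>lborel) \<partial>lborel)"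
  proof (intro nn_integral_mono)
    fix x y :: "real \<times> real"
    have "\<bar>g x \<bullet> g y\<bar> \<le> c\<^sup>2 * defect_density T H q \<epsilon> x y"
    proof (cases "x \<in> triangle T \<and> y \<in> triangle T")
      case False
      then show ?thesis by (auto simp: g_def regularized_def defect_density_def)
    next
      case True
      define w where "w z = kernel_weight H q \<eta> z - kernel_weight H q \<epsilon> z" for z
      have "g z = (c * w z) *\<^sub>R \<Phi> z" if "z \<in> triangle T" for z
        using that by (simp add: g_def regularized_def w_def algebra_simps)
      then have eq: "g x \<bullet> g y = c\<^sup>2 * (w x * w y * increment_cov H x y ^ (2 * q - 1))"
        using True inner by (simp add: power2_eq_square)
      show ?thesis
      proof (cases "fst x < snd x \<and> fst y < snd y")
        case False
        then have "increment_cov H x y = 0"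
          using True increment_cov_degenerate[of x H y] increment_cov_degenerate[of y H x]
          by (auto simp: triangle_iff)
        then show ?thesis using q by (simp add: eq defect_density_def power_0_left)
      next
        case pos: True
        have w: "0 \<le> w z" "w z \<le> kernel_weight H q 0 z - kernel_weight H q \<epsilon> z"
          if "fst z < snd z" for z
          using kernel_weight_antimono[OF that, of 0 \<eta> H q]
            kernel_weight_antimono[OF that, of \<eta> \<epsilon> H q] assms by (auto simp: w_def)
        have "w x * w y * \<bar>increment_cov H x y\<bar> ^ (2 * q - 1) \<le> defect_density T H q \<epsilon> x y"
          unfolding defect_density_def using True pos w[of x] w[of y]
          by (auto intro!: mult_mono)
        then have "c\<^sup>2 * (w x * w y * \<bar>increment_cov H x y\<bar> ^ (2 * q - 1))
            \<le> c\<^sup>2 * defect_density T H q \<epsilon> x y"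
          by (intro mult_left_mono) auto
        then show ?thesis using pos w[of x] w[of y] by (simp add: eq abs_mult power_abs)
      qed
    qed
    then show "ennreal \<bar>g x \<bullet> g y\<bar> \<le> ennreal (c\<^sup>2) * ennreal (defect_density T H q \<epsilon> x y)"
      by (simp flip: ennreal_mult')
  qed
  also have "\<dots> = ennreal (c\<^sup>2) * defect T H q \<epsilon>"
  proof -
    have "(\<lambda>(x, y). ennreal (defect_density T H q \<epsilon> x y)) \<in> borel_measurable (lborel \<Otimes>\<^sub>M lborel)"
      using measurable_defect_density[of T H q \<epsilon>] by (simp add: case_prod_beta)
    then have [measurable]: "(\<lambda>y. ennreal (defect_density T H q \<epsilon> x y)) \<in> borel_measurable lborel"
        "(\<lambda>x. \<integral>\<^sup>+y. ennreal (defect_density T H q \<epsilon> x y) \<partial>lborel) \<in> borel_measurable lborel" for x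
      using lborel.borel_measurable_nn_integral_fst by (auto dest: measurable_Pair2)
    show ?thesis by (simp add: nn_integral_cmult defect_def)
  qed
  finally show ?thesis .
qed

lemma regularized_integral_converges:
  "\<exists>L. ((\<lambda>\<epsilon>. integral\<^sup>L lborel (reg \<epsilon>)) \<longlongrightarrow> L) (at_right 0)"
proof (rule convergent_at_right_0I)
  fix \<delta> :: real assume \<delta>: "0 < \<delta>"
  \<comment> \<open>Dominated convergence was stated along sequences. One good index is enough,
    because the estimate holds for all \<open>\<epsilon> \<le> e n\<close>.\<close>
  define e where "e n = inverse (real (Suc n))" for n
  have "(\<lambda>n. ennreal (c\<^sup>2) * defect T H q (e n)) \<longlonglongrightarrow> ennreal (c\<^sup>2) * 0"
    using LIMSEQ_inverse_real_of_nat unfolding e_def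
    by (intro ennreal_tendsto_cmult defect_tendsto_0[OF T H q CS]) auto
  then have "eventually (\<lambda>n. ennreal (c\<^sup>2) * defect T H q (e n) < ennreal (\<delta>\<^sup>2)) sequentially"
    using \<delta> by (intro order_tendstoD(2)) auto
  then obtain n where n: "ennreal (c\<^sup>2) * defect T H q (e n) < ennreal (\<delta>\<^sup>2)"
    by (auto simp: eventually_sequentially)
  show "\<exists>r>0. \<forall>\<epsilon>. 0 < \<epsilon> \<and> \<epsilon> \<le> r \<longrightarrow>
      dist (integral\<^sup>L lborel (reg \<epsilon>)) (integral\<^sup>L lborel (reg r)) < \<delta>"
  proof (intro exI[of _ "e n"] conjI allI impI)
    fix \<epsilon> assume "0 < \<epsilon> \<and> \<epsilon> \<le> e n"
    then have "ennreal ((norm (integral\<^sup>L lborel (reg \<epsilon>)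
        - integral\<^sup>L lborel (reg (e n))))\<^sup>2) < ennreal (\<delta>\<^sup>2)"
      using norm_regularized_integral_diff n by (blast intro: le_less_trans)
    then have "norm (integral\<^sup>L lborel (reg \<epsilon>) - integral\<^sup>L lborel (reg (e n))) < \<delta>"
      using \<delta> by (auto simp: ennreal_less_iff intro: power2_less_imp_less)
    then show "dist (integral\<^sup>L lborel (reg \<epsilon>)) (integral\<^sup>L lborel (reg (e n))) < \<delta>"
      by (simp add: dist_norm)
  qed (simp add: e_def)
qed

end

section \<open>Covariances of the process, the symmetric power and the transfer to random
  variables\<close>

lemma L2_rv_mult_integrable:
  assumes "X \<in> L2_rv M" "Y \<in> L2_rv M"
  shows "integrable M (\<lambda>\<omega>. X \<omega> * Y \<omega>)"
proof (rule Bochner_Integration.integrable_bound)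
  show "integrable M (\<lambda>\<omega>. (X \<omega>)\<^sup>2 + (Y \<omega>)\<^sup>2)" using assms by (auto simp: L2_rv_def)
  show "(\<lambda>\<omega>. X \<omega> * Y \<omega>) \<in> borel_measurable M" using assms by (auto simp: L2_rv_def)
  have "\<bar>a * b\<bar> \<le> a\<^sup>2 + b\<^sup>2" for a b :: real
  proof -
    have "0 \<le> \<bar>a\<bar> * \<bar>b\<bar>" "2 * (\<bar>a\<bar> * \<bar>b\<bar>) \<le> a\<^sup>2 + b\<^sup>2"
      using sum_squares_bound[of "\<bar>a\<bar>" "\<bar>b\<bar>"] by (simp_all add: mult.assoc)
    then show ?thesis unfolding abs_mult by linarith
  qed
  then show "AE \<omega> in M. norm (X \<omega> * Y \<omega>) \<le> norm ((X \<omega>)\<^sup>2 + (Y \<omega>)\<^sup>2)" by simp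
qed

text \<open>Measurability comes from the Gaussian condition for a one-term combination, square
  integrability from the almost everywhere equal image under \<open>W\<close>.\<close>

lemma fbm_L2:
  assumes fbm: "fractional_brownian_motion M H B" and W: "wiener_isometry M B emb W" and t: "0 \<le> t"
  shows "B t \<in> L2_rv M"
proof -
  have "gaussian_rv M (\<lambda>\<omega>. \<Sum>s\<in>{t}. 1 * B s \<omega>)"
    using fbm t unfolding fractional_brownian_motion_def gaussian_process_def
    by (elim conjE allE[of _ "{t}"] allE[of _ "\<lambda>_. 1"]) simp
  then have B: "B t \<in> borel_measurable M" by (simp add: gaussian_rv_def)
  have "W (emb (indicator {0..t})) \<in> L2_rv M" "AE \<omega> in M. W (emb (indicator {0..t})) \<omega> = B t \<omega>"
    using W t by (auto simp: wiener_isometry_def linear_isometry_into_L2_def)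
  then have "integrable M (\<lambda>\<omega>. (B t \<omega>)\<^sup>2)"
    using B by (subst integrable_cong_AE[where g = "\<lambda>\<omega>. (W (emb (indicator {0..t})) \<omega>)\<^sup>2"])
      (auto simp: L2_rv_def)
  with B show ?thesis by (simp add: L2_rv_def)
qed

text \<open>In the bilinear expansion the powers of single times cancel, leaving the four powers of
  differences.\<close>

lemma fbm_increment_cov:
  assumes fbm: "fractional_brownian_motion M H B" and W: "wiener_isometry M B emb W"
    and t: "0 \<le> a" "0 \<le> b" "0 \<le> c" "0 \<le> d"
  shows "(\<integral>\<omega>. (B b \<omega> - B a \<omega>) * (B d \<omega> - B c \<omega>) \<partial>M) = increment_cov H (a, b) (c, d)"
proof -
  have int: "integrable M (\<lambda>\<omega>. B s \<omega> * B u \<omega>)" if "0 \<le> s" "0 \<le> u" for s u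
    using L2_rv_mult_integrable fbm_L2[OF fbm W] that by blast
  have E: "(\<integral>\<omega>. B u \<omega> * B s \<omega> \<partial>M) = (u powr (2 * H) + s powr (2 * H) - \<bar>u - s\<bar> powr (2 * H)) / 2"
    if "0 \<le> s" "0 \<le> u" for s u
    using fbm that by (simp add: fractional_brownian_motion_def)
  have "(\<integral>\<omega>. (B b \<omega> - B a \<omega>) * (B d \<omega> - B c \<omega>) \<partial>M)
      = (\<integral>\<omega>. B b \<omega> * B d \<omega> - B b \<omega> * B c \<omega> - (B a \<omega> * B d \<omega> - B a \<omega> * B c \<omega>) \<partial>M)"
    by (simp add: algebra_simps)
  also have "\<dots> = increment_cov H (a, b) (c, d)"
    using t by (simp add: int E increment_cov_def field_simps)
  finally show ?thesis .
qed

lemma symmetric_power_closed_subspace: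
  "closed (symmetric_power m tens)" "subspace (symmetric_power m tens)"
  by (auto simp: symmetric_power_def intro: subspace_closure subspace_span)

text \<open>Symmetrising a constant family adds up \<open>fact m\<close> equal terms, so dividing by
  \<open>fact m\<close> recovers the tensor power.\<close>

lemma tensor_pow_in_symmetric_power: "tensor_pow tens h \<in> symmetric_power m tens"
proof -
  have "(\<Sum>\<pi> | \<pi> permutes {..<m}. tens ((\<lambda>_. h) \<circ> \<pi>)) = fact m *\<^sub>R tensor_pow tens h"
    by (simp add: comp_def sum_constant_scaleR card_permutations[of "{..<m}" m])
  then have "fact m *\<^sub>R tensor_pow tens h
      \<in> span (range (\<lambda>h. \<Sum>\<pi> | \<pi> permutes {..<m}. tens (h \<circ> \<pi>)))"
    by (intro span_base) (metis rangeI)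
  from span_scale[OF this, of "inverse (fact m)"] show ?thesis
    unfolding symmetric_power_def using closure_subset by auto
qed

text \<open>\<open>I\<close> is linear only on \<open>S\<close> and up to null sets, so
  \<open>I y - I L\<close> is replaced by \<open>I (y - L)\<close> under the integral, where the
  norm identity applies.\<close>

lemma isometry_converges_L2:
  assumes I: "linear_isometry_into_L2 M c S I" and x: "\<forall>\<^sub>F i in F. x i \<in> S" and L: "L \<in> S"
    and S: "subspace S" and lim: "(x \<longlongrightarrow> L) F"
  shows "converges_L2 M (\<lambda>i. I (x i)) F"
  unfolding converges_L2_def
proof (intro conjI bexI[of _ "I L"])
  have L2: "I y \<in> L2_rv M" if "y \<in> S" for y
    using I that by (auto simp: linear_isometry_into_L2_def)
  then show "\<forall>\<^sub>F i in F. I (x i) \<in> L2_rv M" "I L \<in> L2_rv M"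
    using x L by (auto elim: eventually_mono)
  have dist: "(\<integral>\<omega>. (I y \<omega> - I L \<omega>)\<^sup>2 \<partial>M) = c * (norm (y - L))\<^sup>2" if y: "y \<in> S" for y
  proof -
    have "AE \<omega> in M. I (1 *\<^sub>R y + (- 1) *\<^sub>R L) \<omega> = 1 * I y \<omega> + (- 1) * I L \<omega>"
      using I y L unfolding linear_isometry_into_L2_def by blast
    then have "AE \<omega> in M. (I y \<omega> - I L \<omega>)\<^sup>2 = (I (y - L) \<omega>)\<^sup>2"
      by (auto elim: eventually_mono)
    moreover have diff: "y - L \<in> S" using S y L by (rule subspace_diff)
    ultimately have "(\<integral>\<omega>. (I y \<omega> - I L \<omega>)\<^sup>2 \<partial>M) = (\<integral>\<omega>. (I (y - L) \<omega>)\<^sup>2 \<partial>M)"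
      using L2[OF y] L2[OF L] L2[OF diff]
      by (intro integral_cong_AE) (auto simp: L2_rv_def)
    then show ?thesis using I diff by (simp add: linear_isometry_into_L2_def)
  qed
  have "((\<lambda>i. c * (norm (x i - L))\<^sup>2) \<longlongrightarrow> c * (norm (L - L))\<^sup>2) F"
    by (intro tendsto_intros lim)
  moreover have "c * (norm (L - L))\<^sup>2 = 0" by simp
  ultimately have "((\<lambda>i. c * (norm (x i - L))\<^sup>2) \<longlongrightarrow> 0) F" by metis
  moreover have "\<forall>\<^sub>F i in F. (\<integral>\<omega>. (I (x i) \<omega> - I L \<omega>)\<^sup>2 \<partial>M) = c * (norm (x i - L))\<^sup>2"
    using x by eventually_elim (rule dist)
  ultimately show "((\<lambda>i. \<integral>\<omega>. (I (x i) \<omega> - I L \<omega>)\<^sup>2 \<partial>M) \<longlongrightarrow> 0) F"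
    by (simp add: tendsto_cong)
qed

theorem theorem4p2:
  fixes M :: "'w measure"
    and B :: "real \<Rightarrow> 'w \<Rightarrow> real"
    and H T :: real
    and q :: nat
    and emb :: "(real \<Rightarrow> real) \<Rightarrow> 'h::{real_inner,banach}"
    and W :: "'h \<Rightarrow> 'w \<Rightarrow> real"
    and tens :: "(nat \<Rightarrow> 'h) \<Rightarrow> 'k::{real_inner,banach,second_countable_topology}"
    and I :: "'k \<Rightarrow> 'w \<Rightarrow> real"
  assumes "T > 0" and "q \<ge> 2" and "2 / 3 < H" and "H < 3 / 4"
    and "fractional_brownian_motion M H B"
    and "step_completion M B emb"
    and "wiener_isometry M B emb W"
    and "hilbert_tensor_power (2 * q - 1) tens"
    and "multiple_wiener_integral M W (2 * q - 1) tens I"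
  shows "converges_L2 M (\<lambda>\<epsilon>. I (chaos_kernel emb tens H T q \<epsilon>)) (at_right 0)"
proof -
  let ?S = "symmetric_power (2 * q - 1) tens"
  define \<psi> where "\<psi> z = emb (indicator {fst z..snd z})" for z
  define \<Phi> where "\<Phi> z = tensor_pow tens (\<psi> z)" for z
  define c where "c = (- 1) ^ q * kernel_coeff q"
  have inner_\<psi>: "\<psi> x \<bullet> \<psi> y = increment_cov H x y" if "x \<in> triangle T" "y \<in> triangle T" for x y
    using that assms(6) fbm_increment_cov[OF assms(5,7), of "fst x" "snd x" "fst y" "snd y"]
    by (auto simp: step_completion_def \<psi>_def triangle_iff)
  have inner_\<Phi>: "\<Phi> x \<bullet> \<Phi> y = increment_cov H x y ^ (2 * q - 1)"
    if "x \<in> triangle T" "y \<in> triangle T" for x y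
    using assms(8) inner_\<psi>[OF that] by (simp add: hilbert_tensor_power_def \<Phi>_def)
  have norm_\<psi>: "norm (\<psi> x) = (snd x - fst x) powr H" if "x \<in> triangle T" for x
  proof -
    have "(norm (\<psi> x))\<^sup>2 = (snd x - fst x) powr (2 * H)"
      using inner_\<psi>[OF that that] that
      by (simp add: power2_norm_eq_inner increment_cov_def triangle_iff abs_minus_commute)
    also have "\<dots> = ((snd x - fst x) powr H)\<^sup>2"
      by (simp add: power2_eq_square flip: powr_add)
    finally show ?thesis by simp
  qed
  \<comment> \<open>This inequality between explicit functions comes from realising them as inner
    products and norms of the vectors \<open>\<psi> x\<close>.\<close>
  have CS: "\<bar>increment_cov H x y\<bar> \<le> ((snd x - fst x) * (snd y - fst y)) powr H"
    if "x \<in> triangle T" "y \<in> triangle T" for x y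
    using Cauchy_Schwarz_ineq2[of "\<psi> x" "\<psi> y"] that
    by (simp add: inner_\<psi> norm_\<psi> powr_mult triangle_iff)
  have T: "0 \<le> T" using assms(1) by simp
  note setting = T assms(3,4,2) inner_\<Phi> CS
  have kernel: "chaos_kernel emb tens H T q \<epsilon>
      = integral\<^sup>L lborel (regularized T H c q \<Phi> \<epsilon>)" for \<epsilon>
    unfolding chaos_kernel_def set_lebesgue_integral_def
    by (intro Bochner_Integration.integral_cong)
      (auto simp: regularized_def kernel_at_def triangle_def kernel_weight_def \<Phi>_def \<psi>_def
        c_def)
  obtain L where L: "((\<lambda>\<epsilon>. chaos_kernel emb tens H T q \<epsilon>) \<longlongrightarrow> L) (at_right 0)"
    unfolding kernel using regularized_integral_converges[OF setting] by blast
  \<comment> \<open>Membership is essential: \<open>I\<close> is an isometry only on the symmetric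
    power, so both the kernels and their limit must lie there.\<close>
  have "chaos_kernel emb tens H T q \<epsilon> \<in> ?S" if "0 < \<epsilon>" for \<epsilon>
    unfolding kernel
  proof (rule integral_in_closed_subspace)
    show "integrable lborel (regularized T H c q \<Phi> \<epsilon>)"
      using integrable_regularized[OF setting that] .
    show "regularized T H c q \<Phi> \<epsilon> z \<in> ?S" for z
      unfolding regularized_def \<Phi>_def
      by (intro subspace_scale symmetric_power_closed_subspace tensor_pow_in_symmetric_power)
  qed (rule symmetric_power_closed_subspace)+
  then have ev: "\<forall>\<^sub>F \<epsilon> in at_right 0. chaos_kernel emb tens H T q \<epsilon> \<in> ?S"
    by (auto simp: eventually_at_right_field intro!: exI[of _ 1])
  then have "L \<in> ?S"
    using Lim_in_closed_set[OF symmetric_power_closed_subspace(1) _ _ L] by simp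
  then show ?thesis
    using assms(9) ev L symmetric_power_closed_subspace(2)
    by (intro isometry_converges_L2[where S = ?S and L = L])
      (auto simp: multiple_wiener_integral_def)
qed

end
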